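(* Let $\mathbf{G}$ be a Grothendieck category. Then there do not exist maximal ideals in $\mathbf{G}$.
   Context: An ideal $\mathcal{I}$ of a preadditive category $\mathbf{C}$ is an additive subfunctor of $\operatorname{Hom}_{\mathbf{C}}\colon\mathbf{C}^{op}\times\mathbf{C}\to\mathbf{Ab}$: it assigns to each pair of objects $A,B$ a subgroup $\mathcal{I}(A,B)$ of $\operatorname{Hom}_{\mathbf{C}}(A,B)$ such that $gif\in\mathcal{I}(X,Y)$ for all $f\colon X\to A$, $i\in\mathcal{I}(A,B)$, $g\colon B\to Y$ in $\mathbf{C}$. An ideal is maximal if it is proper (not equal to $\operatorname{Hom}_{\mathbf{C}}$) and is not properly contained in any other proper ideal. *)

theory Defs
  imports "HOL-Algebra.Group"
begin

unbundle cardinal_syntax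

section \<open>Preadditive categories\<close>

text \<open>
  Domain and codomain are functions on morphisms, so different hom-sets are disjoint; \<open>f \<^bold>+ g\<close> is
  meaningful only for parallel \<open>f\<close>, \<open>g\<close>. Outside \<open>Obj\<close> and \<open>Arr\<close> all components are unspecified.
\<close>

record ('o, 'm) precat =
  Obj :: "'o set"
  Arr :: "'m set"
  Dom :: "'m \<Rightarrow> 'o"
  Cod :: "'m \<Rightarrow> 'o"
  Ident :: "'o \<Rightarrow> 'm"  (\<open>\<I>\<index>\<close>)
  Comp :: "'m \<Rightarrow> 'm \<Rightarrow> 'm"  (infixr \<open>\<cdot>\<index>\<close> 70)
  Plus :: "'m \<Rightarrow> 'm \<Rightarrow> 'm"  (infixl \<open>\<^bold>+\<index>\<close> 65)
  Zero :: "'o \<Rightarrow> 'o \<Rightarrow> 'm"  (\<open>\<Z>\<index>\<close>)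

definition Hom :: "('o, 'm, 'z) precat_scheme \<Rightarrow> 'o \<Rightarrow> 'o \<Rightarrow> 'm set"  (\<open>Hom\<index>\<close>)
  where "Hom\<^bsub>C\<^esub> A B = {f \<in> Arr C. Dom C f = A \<and> Cod C f = B}"

text \<open>The abelian group \<open>Hom A B\<close>, in the multiplicative notation of HOL-Algebra.\<close>

definition Hom_group :: "('o, 'm, 'z) precat_scheme \<Rightarrow> 'o \<Rightarrow> 'o \<Rightarrow> 'm monoid"
  where "Hom_group C A B =
    \<lparr>carrier = Hom\<^bsub>C\<^esub> A B, monoid.mult = Plus C, one = Zero C A B\<rparr>"

locale category =
  fixes C :: "('o, 'm, 'z) precat_scheme" (structure)
  assumes dom_cod: "f \<in> Arr C \<Longrightarrow> Dom C f \<in> Obj C \<and> Cod C f \<in> Obj C"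
    and ident_hom: "A \<in> Obj C \<Longrightarrow> \<I> A \<in> Hom A A"
    and comp_hom: "\<lbrakk>f \<in> Hom A B; g \<in> Hom B D\<rbrakk> \<Longrightarrow> g \<cdot> f \<in> Hom A D"
    and comp_ident: "f \<in> Hom A B \<Longrightarrow> f \<cdot> \<I> A = f"
    and ident_comp: "f \<in> Hom A B \<Longrightarrow> \<I> B \<cdot> f = f"
    and comp_assoc:
      "\<lbrakk>f \<in> Hom A B; g \<in> Hom B D; h \<in> Hom D E\<rbrakk> \<Longrightarrow> (h \<cdot> g) \<cdot> f = h \<cdot> (g \<cdot> f)"

locale preadditive_category = category C
  for C :: "('o, 'm, 'z) precat_scheme" (structure) +
  assumes hom_comm_group: "\<lbrakk>A \<in> Obj C; B \<in> Obj C\<rbrakk> \<Longrightarrow> comm_group (Hom_group C A B)"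
    and comp_plus_left:
      "\<lbrakk>f \<in> Hom A B; g \<in> Hom B D; g' \<in> Hom B D\<rbrakk> \<Longrightarrow> (g \<^bold>+ g') \<cdot> f = (g \<cdot> f) \<^bold>+ (g' \<cdot> f)"
    and comp_plus_right:
      "\<lbrakk>f \<in> Hom A B; f' \<in> Hom A B; g \<in> Hom B D\<rbrakk> \<Longrightarrow> g \<cdot> (f \<^bold>+ f') = (g \<cdot> f) \<^bold>+ (g \<cdot> f')"


section \<open>Ideals\<close>

text \<open>
  An ideal is a family of subgroups indexed by pairs of objects. Since the values of such a family
  off \<open>Obj\<close> are irrelevant, inclusion and properness only refer to pairs of objects.
\<close>

context preadditive_category
begin

definition ideal :: "('o \<Rightarrow> 'o \<Rightarrow> 'm set) \<Rightarrow> bool"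
  where "ideal I \<longleftrightarrow>
    (\<forall>A\<in>Obj C. \<forall>B\<in>Obj C. subgroup (I A B) (Hom_group C A B)) \<and>
    (\<forall>X\<in>Obj C. \<forall>A\<in>Obj C. \<forall>B\<in>Obj C. \<forall>Y\<in>Obj C.
      \<forall>f\<in>Hom X A. \<forall>i\<in>I A B. \<forall>g\<in>Hom B Y. g \<cdot> (i \<cdot> f) \<in> I X Y)"

definition ideal_le :: "('o \<Rightarrow> 'o \<Rightarrow> 'm set) \<Rightarrow> ('o \<Rightarrow> 'o \<Rightarrow> 'm set) \<Rightarrow> bool"
  where "ideal_le I J \<longleftrightarrow> (\<forall>A\<in>Obj C. \<forall>B\<in>Obj C. I A B \<subseteq> J A B)"

definition proper_ideal :: "('o \<Rightarrow> 'o \<Rightarrow> 'm set) \<Rightarrow> bool"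
  where "proper_ideal I \<longleftrightarrow> ideal I \<and> (\<exists>A\<in>Obj C. \<exists>B\<in>Obj C. I A B \<noteq> Hom A B)"

definition maximal_ideal :: "('o \<Rightarrow> 'o \<Rightarrow> 'm set) \<Rightarrow> bool"
  where "maximal_ideal I \<longleftrightarrow>
    proper_ideal I \<and> \<not> (\<exists>J. proper_ideal J \<and> ideal_le I J \<and> \<not> ideal_le J I)"

end


section \<open>Abelian categories\<close>

context category
begin

definition mono_arr :: "'m \<Rightarrow> bool"
  where "mono_arr f \<longleftrightarrow> f \<in> Arr C \<and>
    (\<forall>X\<in>Obj C. \<forall>u\<in>Hom X (Dom C f). \<forall>v\<in>Hom X (Dom C f). f \<cdot> u = f \<cdot> v \<longrightarrow> u = v)"

definition epi_arr :: "'m \<Rightarrow> bool"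
  where "epi_arr f \<longleftrightarrow> f \<in> Arr C \<and>
    (\<forall>X\<in>Obj C. \<forall>u\<in>Hom (Cod C f) X. \<forall>v\<in>Hom (Cod C f) X. u \<cdot> f = v \<cdot> f \<longrightarrow> u = v)"

definition zero_object :: "'o \<Rightarrow> bool"
  where "zero_object Z \<longleftrightarrow>
    Z \<in> Obj C \<and> (\<forall>A\<in>Obj C. (\<exists>!f. f \<in> Hom A Z) \<and> (\<exists>!f. f \<in> Hom Z A))"

definition is_coproduct :: "'i set \<Rightarrow> ('i \<Rightarrow> 'o) \<Rightarrow> 'o \<Rightarrow> ('i \<Rightarrow> 'm) \<Rightarrow> bool"
  where "is_coproduct I A S e \<longleftrightarrow>
    S \<in> Obj C \<and> (\<forall>i\<in>I. e i \<in> Hom (A i) S) \<and>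
    (\<forall>X\<in>Obj C. \<forall>f. (\<forall>i\<in>I. f i \<in> Hom (A i) X) \<longrightarrow>
      (\<exists>!h. h \<in> Hom S X \<and> (\<forall>i\<in>I. h \<cdot> e i = f i)))"

definition generator :: "'o \<Rightarrow> bool"
  where "generator G \<longleftrightarrow> G \<in> Obj C \<and>
    (\<forall>A\<in>Obj C. \<forall>B\<in>Obj C. \<forall>f\<in>Hom A B. \<forall>g\<in>Hom A B.
      f \<noteq> g \<longrightarrow> (\<exists>h\<in>Hom G A. f \<cdot> h \<noteq> g \<cdot> h))"

text \<open>Direct systems over a directed preordered set \<open>(I, r)\<close> and their colimits (direct limits).\<close>

definition direct_system :: "'i set \<Rightarrow> 'i rel \<Rightarrow> ('i \<Rightarrow> 'o) \<Rightarrow> ('i \<Rightarrow> 'i \<Rightarrow> 'm) \<Rightarrow> bool"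
  where "direct_system I r A a \<longleftrightarrow>
    (\<forall>i\<in>I. A i \<in> Obj C \<and> a i i = \<I> (A i)) \<and>
    (\<forall>i j. (i, j) \<in> r \<longrightarrow> a i j \<in> Hom (A i) (A j)) \<and>
    (\<forall>i j k. (i, j) \<in> r \<longrightarrow> (j, k) \<in> r \<longrightarrow> a j k \<cdot> a i j = a i k)"

definition system_map :: "'i set \<Rightarrow> 'i rel \<Rightarrow> ('i \<Rightarrow> 'o) \<Rightarrow> ('i \<Rightarrow> 'i \<Rightarrow> 'm) \<Rightarrow>
    ('i \<Rightarrow> 'o) \<Rightarrow> ('i \<Rightarrow> 'i \<Rightarrow> 'm) \<Rightarrow> ('i \<Rightarrow> 'm) \<Rightarrow> bool"
  where "system_map I r A a B b f \<longleftrightarrow>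
    (\<forall>i\<in>I. f i \<in> Hom (A i) (B i)) \<and>
    (\<forall>i j. (i, j) \<in> r \<longrightarrow> f j \<cdot> a i j = b i j \<cdot> f i)"

definition cocone :: "'i set \<Rightarrow> 'i rel \<Rightarrow> ('i \<Rightarrow> 'o) \<Rightarrow> ('i \<Rightarrow> 'i \<Rightarrow> 'm) \<Rightarrow>
    'o \<Rightarrow> ('i \<Rightarrow> 'm) \<Rightarrow> bool"
  where "cocone I r A a L l \<longleftrightarrow>
    L \<in> Obj C \<and> (\<forall>i\<in>I. l i \<in> Hom (A i) L) \<and> (\<forall>i j. (i, j) \<in> r \<longrightarrow> l j \<cdot> a i j = l i)"

definition direct_limit :: "'i set \<Rightarrow> 'i rel \<Rightarrow> ('i \<Rightarrow> 'o) \<Rightarrow> ('i \<Rightarrow> 'i \<Rightarrow> 'm) \<Rightarrow>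
    'o \<Rightarrow> ('i \<Rightarrow> 'm) \<Rightarrow> bool"
  where "direct_limit I r A a L l \<longleftrightarrow>
    cocone I r A a L l \<and>
    (\<forall>X x. cocone I r A a X x \<longrightarrow> (\<exists>!h. h \<in> Hom L X \<and> (\<forall>i\<in>I. h \<cdot> l i = x i)))"

end

context preadditive_category
begin

definition is_kernel :: "'m \<Rightarrow> 'm \<Rightarrow> bool"
  where "is_kernel k f \<longleftrightarrow>
    k \<in> Arr C \<and> f \<in> Arr C \<and> Cod C k = Dom C f \<and> f \<cdot> k = \<Z> (Dom C k) (Cod C f) \<and>
    (\<forall>X\<in>Obj C. \<forall>g\<in>Hom X (Dom C f). f \<cdot> g = \<Z> X (Cod C f) \<longrightarrow>
      (\<exists>!h. h \<in> Hom X (Dom C k) \<and> k \<cdot> h = g))"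

definition is_cokernel :: "'m \<Rightarrow> 'm \<Rightarrow> bool"
  where "is_cokernel c f \<longleftrightarrow>
    c \<in> Arr C \<and> f \<in> Arr C \<and> Dom C c = Cod C f \<and> c \<cdot> f = \<Z> (Dom C f) (Cod C c) \<and>
    (\<forall>X\<in>Obj C. \<forall>g\<in>Hom (Cod C f) X. g \<cdot> f = \<Z> (Dom C f) X \<longrightarrow>
      (\<exists>!h. h \<in> Hom (Cod C c) X \<and> h \<cdot> c = g))"

definition short_exact :: "'m \<Rightarrow> 'm \<Rightarrow> bool"
  where "short_exact f g \<longleftrightarrow> is_kernel f g \<and> is_cokernel g f"

definition is_biproduct :: "'o \<Rightarrow> 'o \<Rightarrow> 'o \<Rightarrow> 'm \<Rightarrow> 'm \<Rightarrow> 'm \<Rightarrow> 'm \<Rightarrow> bool"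
  where "is_biproduct A B S e1 e2 p1 p2 \<longleftrightarrow>
    S \<in> Obj C \<and> e1 \<in> Hom A S \<and> e2 \<in> Hom B S \<and> p1 \<in> Hom S A \<and> p2 \<in> Hom S B \<and>
    p1 \<cdot> e1 = \<I> A \<and> p2 \<cdot> e2 = \<I> B \<and> p1 \<cdot> e2 = \<Z> B A \<and> p2 \<cdot> e1 = \<Z> A B \<and>
    (e1 \<cdot> p1) \<^bold>+ (e2 \<cdot> p2) = \<I> S"

end

locale abelian_category = preadditive_category C
  for C :: "('o, 'm, 'z) precat_scheme" (structure) +
  assumes ex_zero_object: "\<exists>Z. zero_object Z"
    and ex_biproduct: "\<lbrakk>A \<in> Obj C; B \<in> Obj C\<rbrakk> \<Longrightarrow> \<exists>S e1 e2 p1 p2. is_biproduct A B S e1 e2 p1 p2"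
    and ex_kernel: "f \<in> Arr C \<Longrightarrow> \<exists>k. is_kernel k f"
    and ex_cokernel: "f \<in> Arr C \<Longrightarrow> \<exists>c. is_cokernel c f"
    and mono_normal: "mono_arr f \<Longrightarrow> \<exists>g. is_kernel f g"
    and epi_normal: "epi_arr f \<Longrightarrow> \<exists>g. is_cokernel f g"


section \<open>Grothendieck categories\<close>

text \<open>
  Smallness is measured by a universe \<open>U\<close> whose cardinality is uncountable and (strongly)
  inaccessible, i.e. the cardinality of a Grothendieck universe containing the natural numbers.
  A set of any type is small if it has fewer than \<open>|U|\<close> elements. Small index sets may be taken to
  be subsets of \<open>U\<close>, because every small set is in bijection with one.
\<close>

definition universe :: "'u set \<Rightarrow> bool"
  where "universe U \<longleftrightarrow>
    |UNIV :: nat set| <o |U| \<and> regularCard |U| \<and> (\<forall>X\<subseteq>U. |X| <o |U| \<longrightarrow> |Pow X| <o |U| )"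

definition small :: "'u set \<Rightarrow> 'a set \<Rightarrow> bool"
  where "small U X \<longleftrightarrow> |X| <o |U|"

definition directed_preorder :: "'i set \<Rightarrow> 'i rel \<Rightarrow> bool"
  where "directed_preorder I r \<longleftrightarrow>
    preorder_on I r \<and> I \<noteq> {} \<and> (\<forall>i\<in>I. \<forall>j\<in>I. \<exists>k\<in>I. (i, k) \<in> r \<and> (j, k) \<in> r)"

text \<open>
  In the presence of cokernels, small coproducts give all small colimits, so the category is
  cocomplete. Exactness of direct limits (AB5) says that, for a direct system of short exact
  sequences, the induced sequence \<open>u\<close>, \<open>v\<close> on the direct limits is short exact.
  The class of objects is not required to be small.
\<close>

locale grothendieck_category = abelian_category C
  for U :: "'u set" and C :: "('o, 'm, 'z) precat_scheme" (structure) +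
  assumes locally_small: "\<lbrakk>A \<in> Obj C; B \<in> Obj C\<rbrakk> \<Longrightarrow> small U (Hom A B)"
    and ex_coproduct: "\<lbrakk>I \<subseteq> U; small U I; \<And>i. i \<in> I \<Longrightarrow> F i \<in> Obj C\<rbrakk> \<Longrightarrow>
      \<exists>S e. is_coproduct I F S e"
    and direct_limits_exact:
      "\<lbrakk>I \<subseteq> U; small U I; directed_preorder I r;
        direct_system I r A1 a1; direct_system I r A2 a2; direct_system I r A3 a3;
        system_map I r A1 a1 A2 a2 f; system_map I r A2 a2 A3 a3 g;
        \<And>i. i \<in> I \<Longrightarrow> short_exact (f i) (g i);
        direct_limit I r A1 a1 L1 l1; direct_limit I r A2 a2 L2 l2; direct_limit I r A3 a3 L3 l3;
        u \<in> Hom L1 L2; \<And>i. i \<in> I \<Longrightarrow> u \<cdot> l1 i = l2 i \<cdot> f i;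
        v \<in> Hom L2 L3; \<And>i. i \<in> I \<Longrightarrow> v \<cdot> l2 i = l3 i \<cdot> g i\<rbrakk> \<Longrightarrow>
      short_exact u v"
    and ex_generator: "\<exists>G. generator G"

end

theory Submission
  imports Defs
begin

text \<open>
  Let \<open>M\<close> be a proper ideal, \<open>A\<close> an object with \<open>\<I> A \<notin> M A A\<close>, and \<open>G\<close> a generator. Choose an infinite
  cardinal \<open>\<lambda> \<ge> |Hom G A|\<close>, a small index set \<open>I\<close> with \<open>|I| > \<lambda>\<close>, and let \<open>B\<close> be the coproduct of \<open>|I|\<close>
  copies of \<open>A\<close> with projections \<open>p i\<close>. The morphisms \<open>f : X \<rightarrow> Y\<close> such that, for every \<open>y : Y \<rightarrow> B\<close>, at
  most \<open>\<lambda>\<close> of the components \<open>p i \<cdot> y \<cdot> f\<close> lie outside \<open>M\<close> form an ideal \<open>J \<supseteq> M\<close> that does not contain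
  \<open>\<I> B\<close>. It contains \<open>\<I> A\<close>, so that \<open>M\<close> is not maximal: by AB5, \<open>A\<close> is covered by morphisms \<open>h : G \<rightarrow> A\<close>
  for which \<open>y \<cdot> h\<close> has only finitely many nonzero components, so \<open>y : A \<rightarrow> B\<close> has at most \<open>\<lambda>\<close> of them.
\<close>

section \<open>Epimorphisms, coproducts and direct systems\<close>

context category
begin

lemma Hom_obj:
  assumes "f \<in> Hom A B"
  shows "A \<in> Obj C" "B \<in> Obj C"
  using assms dom_cod by (auto simp: Hom_def)

lemma Hom_ends:
  assumes "f \<in> Hom A B"
  shows "f \<in> Arr C" "Dom C f = A" "Cod C f = B"
  using assms by (auto simp: Hom_def)

lemma epi_arrD:
  assumes "epi_arr c" "c \<in> Hom A B" "u \<in> Hom B X" "v \<in> Hom B X" "u \<cdot> c = v \<cdot> c"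
  shows "u = v"
  using assms Hom_obj(2)[OF assms(3)] Hom_ends[OF assms(2)] unfolding epi_arr_def by blast

lemma epi_arr_comp:
  assumes "epi_arr c" "c \<in> Hom A B" "epi_arr d" "d \<in> Hom B D"
  shows "epi_arr (d \<cdot> c)"
  unfolding epi_arr_def
proof (intro conjI ballI impI)
  have dc: "d \<cdot> c \<in> Hom A D" using comp_hom assms by blast
  then show "d \<cdot> c \<in> Arr C" by (rule Hom_ends)
  fix X u v
  assume "u \<in> Hom (Cod C (d \<cdot> c)) X" "v \<in> Hom (Cod C (d \<cdot> c)) X" and eq: "u \<cdot> d \<cdot> c = v \<cdot> d \<cdot> c"
  then have uv: "u \<in> Hom D X" "v \<in> Hom D X" using Hom_ends[OF dc] by auto
  then have "(u \<cdot> d) \<cdot> c = (v \<cdot> d) \<cdot> c"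
    using eq comp_assoc[OF assms(2,4)] by simp
  then have "u \<cdot> d = v \<cdot> d"
    using epi_arrD[OF assms(1,2)] comp_hom[OF assms(4)] uv by blast
  then show "u = v" using epi_arrD[OF assms(3,4)] uv by blast
qed

lemma coproduct_hom:
  assumes "is_coproduct I F S e"
  shows "i \<in> I \<Longrightarrow> e i \<in> Hom (F i) S"
  using assms unfolding is_coproduct_def by blast

lemma coproduct_induced:
  assumes "is_coproduct I F S e" "X \<in> Obj C" "\<And>i. i \<in> I \<Longrightarrow> f i \<in> Hom (F i) X"
  obtains h where "h \<in> Hom S X" "\<And>i. i \<in> I \<Longrightarrow> h \<cdot> e i = f i"
  using assms unfolding is_coproduct_def by blast

lemma coproduct_eqI:
  assumes S: "is_coproduct I F S e" and gh: "g \<in> Hom S X" "h \<in> Hom S X"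
    and eq: "\<And>i. i \<in> I \<Longrightarrow> g \<cdot> e i = h \<cdot> e i"
  shows "g = h"
proof -
  have "X \<in> Obj C" using gh Hom_obj by blast
  moreover have "\<forall>i\<in>I. h \<cdot> e i \<in> Hom (F i) X"
    using coproduct_hom[OF S] comp_hom gh by blast
  ultimately have "\<exists>!k. k \<in> Hom S X \<and> (\<forall>i\<in>I. k \<cdot> e i = h \<cdot> e i)"
    using S unfolding is_coproduct_def by (elim conjE) (drule bspec, assumption, drule spec, erule mp)
  then show ?thesis using gh eq by (metis (no_types, lifting))
qed

lemma zero_object_eqI:
  assumes "zero_object Z" "f \<in> Hom Z A" "g \<in> Hom Z A"
  shows "f = g"
  using assms Hom_obj unfolding zero_object_def by metis

text \<open>The identity and composition laws for \<open>a'\<close> may be tested after composing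
  with the epimorphisms \<open>c i\<close>, where they become the laws of the system
  \<open>a\<close>. This turns coimages and cokernels into direct systems without further
  computation.\<close>

lemma direct_system_quotient:
  assumes sys: "direct_system I r A a" and rI: "preorder_on I r"
    and c: "\<And>i. i \<in> I \<Longrightarrow> c i \<in> Hom (A i) (A' i)" "\<And>i. i \<in> I \<Longrightarrow> epi_arr (c i)"
    and a': "\<And>i j. (i, j) \<in> r \<Longrightarrow> a' i j \<in> Hom (A' i) (A' j)"
      "\<And>i j. (i, j) \<in> r \<Longrightarrow> a' i j \<cdot> c i = c j \<cdot> a i j"
  shows "direct_system I r A' a'"
  unfolding direct_system_def
proof (intro conjI ballI allI impI)
  have rI': "r \<subseteq> I \<times> I" "\<And>i. i \<in> I \<Longrightarrow> (i, i) \<in> r" "\<And>i j k. (i, j) \<in> r \<Longrightarrow> (j, k) \<in> r \<Longrightarrow> (i, k) \<in> r"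
    using rI by (auto simp: preorder_on_def refl_on_def dest: transD)
  have a: "\<And>i. i \<in> I \<Longrightarrow> a i i = \<I> (A i)" "\<And>i j. (i, j) \<in> r \<Longrightarrow> a i j \<in> Hom (A i) (A j)"
    "\<And>i j k. (i, j) \<in> r \<Longrightarrow> (j, k) \<in> r \<Longrightarrow> a j k \<cdot> a i j = a i k"
    using sys unfolding direct_system_def by blast+
  show "A' i \<in> Obj C" if "i \<in> I" for i using c(1) that Hom_obj by blast
  then show "a' i i = \<I> (A' i)" if "i \<in> I" for i
    using epi_arrD[OF c(2) c(1), OF that that a'(1)] rI'(2)[OF that] a'(2) a(1)[OF that] that
      comp_ident[OF c(1)] ident_comp[OF c(1)] ident_hom by metis
  show "a' i j \<in> Hom (A' i) (A' j)" if "(i, j) \<in> r" for i j using a' that by blast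
  fix i j k assume r: "(i, j) \<in> r" "(j, k) \<in> r"
  then have ik: "(i, k) \<in> r" "i \<in> I" "j \<in> I" "k \<in> I" using rI' by blast+
  note h = c(1)[OF ik(2)] c(1)[OF ik(3)] c(1)[OF ik(4)] a(2)[OF r(1)] a(2)[OF r(2)] a'(1)[OF r(1)] a'(1)[OF r(2)]
  have "(a' j k \<cdot> a' i j) \<cdot> c i = a' j k \<cdot> c j \<cdot> a i j"
    using comp_assoc[OF h(1,6,7)] a'(2)[OF r(1)] by simp
  also have "\<dots> = (c k \<cdot> a j k) \<cdot> a i j"
    using comp_assoc[OF h(4,2,7)] a'(2)[OF r(2)] by simp
  also have "\<dots> = a' i k \<cdot> c i"
    using comp_assoc[OF h(4,5,3)] a(3)[OF r] a'(2)[OF ik(1)] by simp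
  finally show "a' j k \<cdot> a' i j = a' i k"
    using epi_arrD[OF c(2)[OF ik(2)] h(1) comp_hom[OF h(6,7)] a'(1)[OF ik(1)]] by blast
qed

end

section \<open>Zero morphisms, kernels and cokernels\<close>

context preadditive_category
begin

lemma hom_group: "\<lbrakk>A \<in> Obj C; B \<in> Obj C\<rbrakk> \<Longrightarrow> group (Hom_group C A B)"
  using hom_comm_group comm_group_def by blast

lemma Hom_group_simps:
  "carrier (Hom_group C A B) = Hom A B"
  "monoid.mult (Hom_group C A B) = Plus C"
  "one (Hom_group C A B) = \<Z> A B"
  by (auto simp: Hom_group_def)

lemma zero_hom: "\<lbrakk>A \<in> Obj C; B \<in> Obj C\<rbrakk> \<Longrightarrow> \<Z> A B \<in> Hom A B"
  using monoid.one_closed[OF group.is_monoid[OF hom_group]] by (simp add: Hom_group_simps)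

lemma plus_hom:
  assumes "f \<in> Hom A B" "g \<in> Hom A B" shows "f \<^bold>+ g \<in> Hom A B"
  using monoid.m_closed[OF group.is_monoid[OF hom_group]] assms Hom_obj[OF assms(1)]
  by (metis Hom_group_simps(1,2))

lemma plus_zero:
  assumes "f \<in> Hom A B" shows "f \<^bold>+ \<Z> A B = f" "\<Z> A B \<^bold>+ f = f"
  using monoid.r_one[OF group.is_monoid[OF hom_group]] monoid.l_one[OF group.is_monoid[OF hom_group]]
    assms Hom_obj[OF assms] by (metis Hom_group_simps)+

text \<open>Cancellation in the hom-group. Bilinearity makes any composite with a zero morphism
  idempotent under addition, so the absorption laws for zero follow from this.\<close>

lemma plus_idem_zero:
  assumes "f \<in> Hom A B" "f \<^bold>+ f = f" shows "f = \<Z> A B"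
  using group.l_cancel_one[OF hom_group, of A B f f] assms Hom_obj[OF assms(1)]
  by (simp add: Hom_group_simps)

lemma comp_zero:
  assumes "g \<in> Hom B D" "A \<in> Obj C" shows "g \<cdot> \<Z> A B = \<Z> A D"
  using plus_idem_zero comp_plus_right[OF _ _ assms(1)] zero_hom[OF assms(2)] Hom_obj[OF assms(1)]
    plus_zero comp_hom[OF _ assms(1)] by metis

lemma zero_comp:
  assumes "f \<in> Hom A B" "D \<in> Obj C" shows "\<Z> B D \<cdot> f = \<Z> A D"
  using plus_idem_zero comp_plus_left[OF assms(1)] zero_hom[OF _ assms(2)] Hom_obj[OF assms(1)]
    plus_zero comp_hom[OF assms(1)] by metis

text \<open>Two morphisms that agree after \<open>f\<close> differ by a morphism killed by
  \<open>f\<close>; the difference is formed with \<open>w\<close>, the negative of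
  \<open>v\<close>.\<close>

lemma mono_arrI:
  assumes f: "f \<in> Hom A B"
    and ker: "\<And>X u. u \<in> Hom X A \<Longrightarrow> f \<cdot> u = \<Z> X B \<Longrightarrow> u = \<Z> X A"
  shows "mono_arr f"
  unfolding mono_arr_def
proof (intro conjI ballI impI)
  show "f \<in> Arr C" using f by (rule Hom_ends)
  fix X u v
  assume X: "X \<in> Obj C" and "u \<in> Hom X (Dom C f)" "v \<in> Hom X (Dom C f)" and eq: "f \<cdot> u = f \<cdot> v"
  then have uv: "u \<in> Hom X A" "v \<in> Hom X A" using Hom_ends[OF f] by auto
  interpret group "Hom_group C X A" using hom_group X Hom_obj[OF f] by blast
  define w where "w = m_inv (Hom_group C X A) v"
  have w: "w \<in> Hom X A" "v \<^bold>+ w = \<Z> X A" "w \<^bold>+ v = \<Z> X A"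
    using uv inv_closed r_inv l_inv by (auto simp: w_def Hom_group_simps)
  have "f \<cdot> (u \<^bold>+ w) = \<Z> X B"
    using comp_plus_right[OF uv(1) w(1) f] comp_plus_right[OF uv(2) w(1) f] eq w(2) comp_zero[OF f X] by simp
  then have "u \<^bold>+ w = \<Z> X A" using ker plus_hom uv w by blast
  then show "u = v"
    using w uv right_cancel[of w u v] by (simp add: Hom_group_simps)
qed

lemma kernel_hom:
  assumes "is_kernel k f" "f \<in> Hom A B"
  obtains K where "k \<in> Hom K A" "f \<cdot> k = \<Z> K B"
  using assms Hom_ends[OF assms(2)] unfolding is_kernel_def by (auto simp: Hom_def)

lemma kernel_factor:
  assumes "is_kernel k f" "k \<in> Hom K A" "f \<in> Hom A B" "g \<in> Hom X A" "f \<cdot> g = \<Z> X B"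
  obtains h where "h \<in> Hom X K" "k \<cdot> h = g"
  using assms Hom_ends[OF assms(2)] Hom_ends[OF assms(3)] Hom_obj[OF assms(4)]
  unfolding is_kernel_def by metis

text \<open>The composite \<open>k \<cdot> u\<close> is itself killed by \<open>f\<close>, so the
  uniqueness clause of the kernel applies to it.\<close>

lemma kernel_cancel:
  assumes k: "is_kernel k f" "k \<in> Hom K A" and uv: "u \<in> Hom X K" "v \<in> Hom X K" and eq: "k \<cdot> u = k \<cdot> v"
  shows "u = v"
proof -
  have f: "f \<in> Hom A (Cod C f)" and fk: "f \<cdot> k = \<Z> K (Cod C f)"
    using k Hom_ends[OF k(2)] unfolding is_kernel_def by (auto simp: Hom_def)
  have "f \<cdot> k \<cdot> u = \<Z> X (Cod C f)"
    using comp_assoc[OF uv(1) k(2) f] fk zero_comp[OF uv(1)] Hom_obj[OF f] by simp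
  then have "\<exists>!h. h \<in> Hom X K \<and> k \<cdot> h = k \<cdot> u"
    using k(1) Hom_ends[OF k(2)] Hom_ends[OF f] comp_hom[OF uv(1) k(2)] Hom_obj[OF uv(1)]
    unfolding is_kernel_def by metis
  then show ?thesis using uv eq by metis
qed

lemma cokernel_hom:
  assumes "is_cokernel c f" "f \<in> Hom A B"
  obtains D where "c \<in> Hom B D" "c \<cdot> f = \<Z> A D"
  using assms Hom_ends[OF assms(2)] unfolding is_cokernel_def by (auto simp: Hom_def)

lemma cokernel_factor:
  assumes "is_cokernel c f" "c \<in> Hom B D" "f \<in> Hom A B" "g \<in> Hom B X" "g \<cdot> f = \<Z> A X"
  obtains h where "h \<in> Hom D X" "h \<cdot> c = g"
  using assms Hom_ends[OF assms(2)] Hom_ends[OF assms(3)] Hom_obj[OF assms(4)]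
  unfolding is_cokernel_def by metis

lemma cokernel_epi:
  assumes "is_cokernel c f"
  shows "epi_arr c"
  unfolding epi_arr_def
proof (intro conjI ballI impI)
  show "c \<in> Arr C" using assms unfolding is_cokernel_def by blast
  fix X u v
  assume X: "X \<in> Obj C" and uv: "u \<in> Hom (Cod C c) X" "v \<in> Hom (Cod C c) X" and eq: "u \<cdot> c = v \<cdot> c"
  let ?A = "Dom C f" and ?B = "Cod C f" and ?D = "Cod C c"
  have f: "f \<in> Hom ?A ?B" and c: "c \<in> Hom ?B ?D" and cf: "c \<cdot> f = \<Z> ?A ?D"
    using assms unfolding is_cokernel_def by (auto simp: Hom_def)
  have "(u \<cdot> c) \<cdot> f = \<Z> ?A X"
    using comp_assoc[OF f c uv(1)] cf comp_zero[OF uv(1)] Hom_obj[OF f] by simp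
  then have "\<exists>!h. h \<in> Hom ?D X \<and> h \<cdot> c = u \<cdot> c"
    using assms comp_hom[OF c uv(1)] X unfolding is_cokernel_def by metis
  then show "u = v" using uv eq by metis
qed

text \<open>A kernel is the kernel of its own cokernel: \<open>g\<close> kills \<open>m\<close>,
  hence factors through \<open>d\<close>, so whatever \<open>d\<close> kills is killed by
  \<open>g\<close> and factors through \<open>m\<close>.\<close>

lemma short_exact_cokernel:
  assumes m: "is_kernel m g" and d: "is_cokernel d m"
  shows "short_exact m d"
proof -
  define K A B where "K = Dom C m" and "A = Cod C m" and "B = Cod C g"
  have mh: "m \<in> Hom K A" and gh: "g \<in> Hom A B" and gm: "g \<cdot> m = \<Z> K B"
    using m unfolding is_kernel_def K_def A_def B_def by (auto simp: Hom_def)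
  obtain D where dh: "d \<in> Hom A D" and dm: "d \<cdot> m = \<Z> K D" using cokernel_hom[OF d mh] .
  obtain t where t: "t \<in> Hom D B" "t \<cdot> d = g" using cokernel_factor[OF d dh mh gh gm] .
  have "\<exists>!h. h \<in> Hom X K \<and> m \<cdot> h = y" if y: "y \<in> Hom X A" "d \<cdot> y = \<Z> X D" for X y
  proof -
    have "g \<cdot> y = \<Z> X B"
      using comp_assoc[OF y(1) dh t(1)] t y comp_zero[OF t(1)] Hom_obj[OF y(1)] by simp
    then obtain h where "h \<in> Hom X K" "m \<cdot> h = y" using kernel_factor[OF m mh gh y(1)] by blast
    then show ?thesis using kernel_cancel[OF m mh] by metis
  qed
  then have "is_kernel m d"
    using Hom_ends[OF mh] Hom_ends[OF dh] dm unfolding is_kernel_def by metis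
  then show ?thesis using d unfolding short_exact_def by blast
qed

end

section \<open>Factorization through the coimage\<close>

text \<open>If \<open>m\<close> kills \<open>u\<close>, it factors through the cokernel
  \<open>q\<close> of \<open>u\<close>. The epimorphism \<open>q \<cdot> c\<close> is the cokernel
  of some \<open>h\<close>, and \<open>f\<close> kills \<open>h\<close>, so \<open>h\<close> factors
  through \<open>k\<close> and \<open>c\<close> kills \<open>h\<close> too. Hence \<open>c\<close>
  factors through \<open>q \<cdot> c\<close>, which provides a left inverse \<open>w\<close> of
  \<open>q\<close>; as \<open>q\<close> kills \<open>u\<close>, so does the identity.\<close>

lemma (in abelian_category) coimage_mono:
  assumes f: "f \<in> Hom A B" and k: "is_kernel k f" and ck: "is_cokernel c k"
    and c: "c \<in> Hom A D" and m: "m \<in> Hom D B" and mc: "m \<cdot> c = f"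
  shows "mono_arr m"
proof (rule mono_arrI[OF m])
  fix X u assume u: "u \<in> Hom X D" and mu: "m \<cdot> u = \<Z> X B"
  obtain K where kh: "k \<in> Hom K A" using kernel_hom[OF k f] .
  then have ck0: "c \<cdot> k = \<Z> K D" using cokernel_hom[OF ck kh] c Hom_ends by metis
  obtain q where q: "is_cokernel q u" using ex_cokernel Hom_ends[OF u] by blast
  obtain E where qh: "q \<in> Hom D E" and qu: "q \<cdot> u = \<Z> X E" using cokernel_hom[OF q u] .
  obtain m' where m': "m' \<in> Hom E B" "m' \<cdot> q = m" using cokernel_factor[OF q qh u m mu] .
  have qc: "q \<cdot> c \<in> Hom A E" using comp_hom[OF c qh] .
  obtain h where h: "is_cokernel (q \<cdot> c) h"
    using epi_normal epi_arr_comp[OF cokernel_epi[OF ck] c cokernel_epi[OF q] qh] by blast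
  define H where "H = Dom C h"
  have hh: "h \<in> Hom H A" and qch: "(q \<cdot> c) \<cdot> h = \<Z> H E"
    using h Hom_ends[OF qc] unfolding is_cokernel_def H_def by (auto simp: Hom_def)
  have "f \<cdot> h = (m' \<cdot> (q \<cdot> c)) \<cdot> h"
    using comp_assoc[OF c qh m'(1)] m' mc by simp
  also have "\<dots> = \<Z> H B"
    using comp_assoc[OF hh qc m'(1)] qch comp_zero[OF m'(1)] Hom_obj[OF hh] by simp
  finally obtain h' where h': "h' \<in> Hom H K" "k \<cdot> h' = h"
    using kernel_factor[OF k kh f hh] by blast
  have "c \<cdot> h = \<Z> H D"
    using comp_assoc[OF h'(1) kh c] h' ck0 zero_comp[OF h'(1)] Hom_obj[OF c] by simp
  then obtain w where w: "w \<in> Hom E D" "w \<cdot> (q \<cdot> c) = c"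
    using cokernel_factor[OF h qc hh c] by blast
  have "(w \<cdot> q) \<cdot> c = \<I> D \<cdot> c"
    using comp_assoc[OF c qh w(1)] w ident_comp[OF c] by simp
  then have "w \<cdot> q = \<I> D"
    using epi_arrD[OF cokernel_epi[OF ck] c comp_hom[OF qh w(1)]] ident_hom Hom_obj[OF c] by blast
  then show "u = \<Z> X D"
    using comp_assoc[OF u qh w(1)] ident_comp[OF u] qu comp_zero[OF w(1)] Hom_obj[OF u] by simp
qed

text \<open>The image of \<open>f\<close> is presented as a quotient of \<open>A\<close> by the
  given kernel, so that maps out of it are controlled by maps out of \<open>A\<close>. Its
  monomorphism into \<open>B\<close> is normal, which makes it the left half of a short exact
  sequence.\<close>

lemma (in abelian_category) coimage_factorization:
  assumes f: "f \<in> Hom A B" and k: "is_kernel k f"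
  obtains c D m d where "is_cokernel c k" "c \<in> Hom A D" "m \<in> Hom D B" "m \<cdot> c = f" "short_exact m d"
proof -
  obtain K where kh: "k \<in> Hom K A" and fk: "f \<cdot> k = \<Z> K B" using kernel_hom[OF k f] .
  obtain c where ck: "is_cokernel c k" using ex_cokernel Hom_ends[OF kh] by blast
  obtain D where c: "c \<in> Hom A D" using cokernel_hom[OF ck kh] .
  obtain m where m: "m \<in> Hom D B" "m \<cdot> c = f" using cokernel_factor[OF ck c kh f fk] .
  obtain g where "is_kernel m g" using mono_normal coimage_mono[OF f k ck c m] by blast
  moreover obtain d where "is_cokernel d m" using ex_cokernel Hom_ends[OF m(1)] by blast
  ultimately show thesis using that short_exact_cokernel ck c m by blast
qed

section \<open>Exactness of direct limits and families of kernels\<close>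

text \<open>A kernel can be cancelled on the left; if it is zero, cancelling it identifies the
  identity of \<open>Q\<close> with zero.\<close>

lemma (in preadditive_category) zero_monoD:
  assumes k: "is_kernel (\<Z> Q Z) g" and q: "q \<in> Hom A Q" and Z: "Z \<in> Obj C"
  shows "q = \<Z> A Q"
proof -
  have Q: "Q \<in> Obj C" using Hom_obj[OF q] by blast
  have "\<I> Q = \<Z> Q Q"
    using kernel_cancel[OF k zero_hom[OF Q Z] ident_hom[OF Q] zero_hom[OF Q Q]]
      comp_ident[OF zero_hom[OF Q Z]] comp_zero[OF zero_hom[OF Q Z] Q] by simp
  then show ?thesis using ident_comp[OF q] zero_comp[OF q Q] by simp
qed

text \<open>
  The coimages of the \<open>R j \<cdot> b\<close>, the constant system on \<open>B\<close> (with transition maps \<open>R j\<close>) and the cokernels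
  form a direct system of short exact sequences. Its middle and right terms have limit \<open>0\<close>, and the
  left terms have as limit the quotient of \<open>A\<close> by the sum of the kernels of the
  \<open>R j \<cdot> b\<close>; by AB5 this quotient vanishes.
\<close>

lemma (in grothendieck_category) kernels_jointly_epi:
  assumes JU: "J \<subseteq> U" "small U J" and dir: "directed_preorder J r"
    and R: "\<And>j. j \<in> J \<Longrightarrow> R j \<in> Hom B B"
    and RR: "\<And>i j. (i, j) \<in> r \<Longrightarrow> R j \<cdot> R i = R j"
    and anti: "antisym r"
    and lim: "\<And>X l i. i \<in> J \<Longrightarrow> (\<And>j. j \<in> J \<Longrightarrow> l j \<in> Hom B X) \<Longrightarrow>
      (\<And>i j. (i, j) \<in> r \<Longrightarrow> i \<noteq> j \<Longrightarrow> l j \<cdot> R j = l i) \<Longrightarrow> l i = \<Z> B X"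
    and b: "b \<in> Hom A B" and x: "x \<in> Hom A X"
    and k: "\<And>j. j \<in> J \<Longrightarrow> is_kernel (k j) (R j \<cdot> b)" "\<And>j. j \<in> J \<Longrightarrow> k j \<in> Hom (K j) A"
    and xk: "\<And>j. j \<in> J \<Longrightarrow> x \<cdot> k j = \<Z> (K j) X"
  shows "x = \<Z> A X"
proof -
  have pre: "preorder_on J r" and ne: "J \<noteq> {}"
    and up: "\<And>i j. i \<in> J \<Longrightarrow> j \<in> J \<Longrightarrow> \<exists>k\<in>J. (i, k) \<in> r \<and> (j, k) \<in> r"
    using dir unfolding directed_preorder_def by blast+
  then have rJ: "\<And>i j. (i, j) \<in> r \<Longrightarrow> i \<in> J \<and> j \<in> J" and refl: "\<And>i. i \<in> J \<Longrightarrow> (i, i) \<in> r"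
    and tr: "\<And>i j k. (i, j) \<in> r \<Longrightarrow> (j, k) \<in> r \<Longrightarrow> (i, k) \<in> r"
    by (auto simp: preorder_on_def refl_on_def dest: transD)
  have A: "A \<in> Obj C" and B: "B \<in> Obj C" and XO: "X \<in> Obj C" using Hom_obj b x by blast+
  define f where "f j = R j \<cdot> b" for j
  have f: "f j \<in> Hom A B" if "j \<in> J" for j using comp_hom[OF b R] that f_def by auto
  have Rf: "R j \<cdot> f i = f j" if "(i, j) \<in> r" for i j
    using comp_assoc[OF b R R] RR[OF that] rJ[OF that] f_def by metis
  \<comment> \<open>The condition \<open>j \<in> J\<close> sits under the existential quantifiers so
    that one application of choice yields total families.\<close>
  have "\<forall>j. \<exists>c D m d E. j \<in> J \<longrightarrow>
      is_cokernel c (k j) \<and> c \<in> Hom A D \<and> m \<in> Hom D B \<and> m \<cdot> c = f j \<and> short_exact m d \<and> d \<in> Hom B E"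
  proof
    fix j
    show "\<exists>c D m d E. j \<in> J \<longrightarrow>
      is_cokernel c (k j) \<and> c \<in> Hom A D \<and> m \<in> Hom D B \<and> m \<cdot> c = f j \<and> short_exact m d \<and> d \<in> Hom B E"
    proof (cases "j \<in> J")
      case True
      then obtain c D m d where *: "is_cokernel c (k j)" "c \<in> Hom A D" "m \<in> Hom D B" "m \<cdot> c = f j" "short_exact m d"
        using coimage_factorization[OF f] k(1) f_def by metis
      moreover obtain E where "d \<in> Hom B E"
        using cokernel_hom[of d m D B] * unfolding short_exact_def by blast
      ultimately show ?thesis by blast
    qed auto
  qed
  then obtain c D m d E where "\<forall>j. j \<in> J \<longrightarrow> is_cokernel (c j) (k j) \<and> c j \<in> Hom A (D j) \<and>
      m j \<in> Hom (D j) B \<and> m j \<cdot> c j = f j \<and> short_exact (m j) (d j) \<and> d j \<in> Hom B (E j)"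
    unfolding choice_iff by blast
  then have c: "\<And>j. j \<in> J \<Longrightarrow> is_cokernel (c j) (k j)" "\<And>j. j \<in> J \<Longrightarrow> c j \<in> Hom A (D j)"
    and m: "\<And>j. j \<in> J \<Longrightarrow> m j \<in> Hom (D j) B" "\<And>j. j \<in> J \<Longrightarrow> m j \<cdot> c j = f j"
    and md: "\<And>j. j \<in> J \<Longrightarrow> short_exact (m j) (d j)" "\<And>j. j \<in> J \<Longrightarrow> d j \<in> Hom B (E j)"
    by blast+
  have epi_c: "epi_arr (c j)" and epi_d: "epi_arr (d j)" and dco: "is_cokernel (d j) (m j)" if "j \<in> J" for j
    using cokernel_epi c md that unfolding short_exact_def by blast+
  have ck0: "c j \<cdot> k j = \<Z> (K j) (D j)" if "j \<in> J" for j
    using cokernel_hom[OF c(1)[OF that] k(2)[OF that]] c(2)[OF that] Hom_ends(3) by metis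
  have dm0: "d j \<cdot> m j = \<Z> (D j) (E j)" if "j \<in> J" for j
    using cokernel_hom[OF dco[OF that] m(1)[OF that]] md(2)[OF that] Hom_ends(3) by metis

  \<comment> \<open>Since \<open>f j = R j \<cdot> f i\<close>, the kernel of \<open>f i\<close> is
    contained in that of \<open>f j\<close>; the coimage of \<open>f j\<close> is therefore a
    quotient of the coimage of \<open>f i\<close>.\<close>
  have "\<exists>a. a \<in> Hom (D i) (D j) \<and> a \<cdot> c i = c j" if r: "(i, j) \<in> r" for i j
  proof -
    have ij: "i \<in> J" "j \<in> J" using rJ r by blast+
    have fk: "f i \<cdot> k i = \<Z> (K i) B"
      using kernel_hom[OF k(1) f[unfolded f_def]] k(2) ij Hom_ends(2) unfolding f_def by metis
    have "f j \<cdot> k i = \<Z> (K i) B"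
      using comp_assoc[OF k(2) f R] Rf[OF r] fk ij comp_zero[OF R] Hom_obj[OF k(2)] by metis
    then obtain t where t: "t \<in> Hom (K i) (K j)" "k j \<cdot> t = k i"
      using kernel_factor[OF k(1) k(2) f[unfolded f_def] k(2)] ij unfolding f_def by metis
    have "c j \<cdot> k i = \<Z> (K i) (D j)"
      using comp_assoc[OF t(1) k(2) c(2)] t ck0 ij zero_comp[OF t(1)] Hom_obj[OF c(2)] by metis
    then show ?thesis using cokernel_factor[OF c(1) c(2) k(2) c(2)] ij by metis
  qed
  then obtain a1 where a1: "\<And>i j. (i, j) \<in> r \<Longrightarrow> a1 i j \<in> Hom (D i) (D j)"
      "\<And>i j. (i, j) \<in> r \<Longrightarrow> a1 i j \<cdot> c i = c j" by metis
  \<comment> \<open>A direct system requires identities on the diagonal, whereas \<open>R j\<close>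
    is in general not an identity. Antisymmetry of \<open>r\<close> makes this case distinction
    compatible with composition: two transitions that compose to a diagonal one are both
    diagonal.\<close>
  define a2 where "a2 i j = (if i = j then \<I> B else R j)" for i j
  have a2h: "a2 i j \<in> Hom B B" if "(i, j) \<in> r" for i j
    using R rJ[OF that] ident_hom[OF B] by (auto simp: a2_def)
  have a2m: "m j \<cdot> a1 i j = a2 i j \<cdot> m i" if r: "(i, j) \<in> r" for i j
  proof -
    have ij: "i \<in> J" "j \<in> J" using rJ r by blast+
    have "(m j \<cdot> a1 i j) \<cdot> c i = f j"
      using comp_assoc[OF c(2) a1(1) m(1)] a1(2) m(2) ij r by metis
    also have "\<dots> = a2 i j \<cdot> f i"
      using Rf[OF r] ident_comp[OF f] ij by (auto simp: a2_def)
    also have "\<dots> = (a2 i j \<cdot> m i) \<cdot> c i"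
      using comp_assoc[OF c(2) m(1) a2h] m(2) ij r by metis
    finally show ?thesis
      using epi_arrD[OF epi_c c(2) comp_hom[OF a1(1) m(1)] comp_hom[OF m(1) a2h]] ij r by metis
  qed
  \<comment> \<open>The square just proved shows that \<open>d j \<cdot> a2 i j\<close> kills
    \<open>m i\<close>, so it descends to the cokernel \<open>d i\<close>.\<close>
  have "\<exists>a. a \<in> Hom (E i) (E j) \<and> a \<cdot> d i = d j \<cdot> a2 i j" if r: "(i, j) \<in> r" for i j
  proof -
    have ij: "i \<in> J" "j \<in> J" using rJ r by blast+
    have "(d j \<cdot> a2 i j) \<cdot> m i = d j \<cdot> m j \<cdot> a1 i j"
      using comp_assoc[OF m(1) a2h md(2)] a2m ij r by metis
    also have "\<dots> = \<Z> (D i) (E j)"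
      using comp_assoc[OF a1(1) m(1) md(2)] dm0 zero_comp[OF a1(1)] Hom_obj[OF md(2)] ij r by metis
    finally show ?thesis
      using cokernel_factor[OF dco md(2) m(1) comp_hom[OF a2h md(2)]] ij r by metis
  qed
  then obtain a3 where a3: "\<And>i j. (i, j) \<in> r \<Longrightarrow> a3 i j \<in> Hom (E i) (E j)"
      "\<And>i j. (i, j) \<in> r \<Longrightarrow> a3 i j \<cdot> d i = d j \<cdot> a2 i j" by metis

  have sysA: "direct_system J r (\<lambda>_. A) (\<lambda>_ _. \<I> A)"
    using A ident_hom comp_ident rJ unfolding direct_system_def by metis
  have sys1: "direct_system J r D a1"
    using direct_system_quotient[OF sysA pre, of c D a1] c(2) epi_c a1 rJ comp_ident[OF c(2)] by metis
  have sys2: "direct_system J r (\<lambda>_. B) a2"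
    unfolding direct_system_def
  proof (intro conjI ballI allI impI)
    fix i j l assume r: "(i, j) \<in> r" "(j, l) \<in> r"
    have "i = l \<longrightarrow> i = j" using r anti by (auto dest: antisymD)
    then show "a2 j l \<cdot> a2 i j = a2 i l"
      using RR[OF r(2)] comp_ident[OF R] ident_comp[OF R] ident_comp[OF ident_hom[OF B]] rJ[OF r(1)] rJ[OF r(2)]
      by (auto simp: a2_def)
  qed (use B a2h in \<open>auto simp: a2_def\<close>)
  have sys3: "direct_system J r E a3"
    using direct_system_quotient[OF sys2 pre, of d E a3] md(2) epi_d a3 by metis

  obtain Z where Z: "zero_object Z" using ex_zero_object by blast
  then have ZO: "Z \<in> Obj C" unfolding zero_object_def by blast
  \<comment> \<open>If every cocone vanishes, the zero object is the limit: the zero morphism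
    mediates, uniquely because it starts at a zero object.\<close>
  have lim0: "direct_limit J r F a Z (\<lambda>j. \<Z> (F j) Z)"
    if sys: "direct_system J r F a"
      and 0: "\<And>X l i. cocone J r F a X l \<Longrightarrow> i \<in> J \<Longrightarrow> l i = \<Z> (F i) X" for F a
  proof -
    have F: "\<And>j. j \<in> J \<Longrightarrow> F j \<in> Obj C" and a: "\<And>i j. (i, j) \<in> r \<Longrightarrow> a i j \<in> Hom (F i) (F j)"
      using sys unfolding direct_system_def by blast+
    have "cocone J r F a Z (\<lambda>j. \<Z> (F j) Z)"
      unfolding cocone_def using ZO zero_hom[OF F ZO] zero_comp[OF a ZO] by blast
    moreover have "\<exists>!h. h \<in> Hom Z X \<and> (\<forall>i\<in>J. h \<cdot> \<Z> (F i) Z = l i)" if co: "cocone J r F a X l" for X l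
    proof -
      have X: "X \<in> Obj C" using co unfolding cocone_def by blast
      have h: "\<Z> Z X \<in> Hom Z X" using zero_hom[OF ZO X] .
      have "\<forall>i\<in>J. \<Z> Z X \<cdot> \<Z> (F i) Z = l i"
        using 0[OF co] comp_zero[OF h] F by simp
      then show ?thesis using h zero_object_eqI[OF Z] by blast
    qed
    ultimately show ?thesis unfolding direct_limit_def by blast
  qed
  have co2: "l i = \<Z> B X" if co: "cocone J r (\<lambda>_. B) a2 X l" and i: "i \<in> J" for X l i
  proof (rule lim[OF i])
    show "l j \<in> Hom B X" if "j \<in> J" for j using co that unfolding cocone_def by blast
    show "l j \<cdot> R j = l i" if "(i, j) \<in> r" "i \<noteq> j" for i j
    proof -
      have "l j \<cdot> a2 i j = l i" using co that unfolding cocone_def by blast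
      then show ?thesis using that by (simp add: a2_def)
    qed
  qed
  \<comment> \<open>Composing with the epimorphisms \<open>d j\<close> gives a cocone on the middle
    system, where \<open>co2\<close> applies.\<close>
  have co3: "l i = \<Z> (E i) X" if co: "cocone J r E a3 X l" and i: "i \<in> J" for X l i
  proof -
    have X: "X \<in> Obj C" and l: "\<And>i. i \<in> J \<Longrightarrow> l i \<in> Hom (E i) X"
      and la: "\<And>i j. (i, j) \<in> r \<Longrightarrow> l j \<cdot> a3 i j = l i"
      using co unfolding cocone_def by blast+
    have "(l j \<cdot> d j) \<cdot> a2 i j = l i \<cdot> d i" if r: "(i, j) \<in> r" for i j
      using comp_assoc[OF a2h md(2) l] comp_assoc[OF md(2) a3(1) l] a3(2) la r rJ[OF r] by metis
    then have "cocone J r (\<lambda>_. B) a2 X (\<lambda>j. l j \<cdot> d j)"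
      unfolding cocone_def using X comp_hom[OF md(2) l] by blast
    then have "l i \<cdot> d i = \<Z> B X" using co2[OF _ i] by blast
    then have "l i \<cdot> d i = \<Z> (E i) X \<cdot> d i" using zero_comp[OF md(2)[OF i] X] by simp
    then show ?thesis
      using epi_arrD[OF epi_d[OF i] md(2)[OF i] l[OF i] zero_hom] Hom_obj[OF md(2)[OF i]] X by blast
  qed
  have lim2: "direct_limit J r (\<lambda>_. B) a2 Z (\<lambda>j. \<Z> B Z)" using lim0[OF sys2] co2 by blast
  have lim3: "direct_limit J r E a3 Z (\<lambda>j. \<Z> (E j) Z)" using lim0[OF sys3] co3 by blast

  \<comment> \<open>The image of \<open>s\<close> is the sum of the kernels in \<open>A\<close>, so
    the cokernel \<open>q\<close> of \<open>s\<close> is the quotient of \<open>A\<close> by that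
    sum; \<open>kill\<close> expresses this for test morphisms.\<close>
  obtain S e where S: "is_coproduct J K S e"
    using ex_coproduct[OF JU] Hom_obj(1)[OF k(2)] by blast
  obtain s where s: "s \<in> Hom S A" "\<And>j. j \<in> J \<Longrightarrow> s \<cdot> e j = k j"
    using coproduct_induced[OF S A k(2)] by blast
  have kill: "y \<cdot> s = \<Z> S Y \<longleftrightarrow> (\<forall>j\<in>J. y \<cdot> k j = \<Z> (K j) Y)" if y: "y \<in> Hom A Y" for y Y
  proof -
    have SO: "S \<in> Obj C" and YO: "Y \<in> Obj C" using Hom_obj s y by blast+
    have 1: "(y \<cdot> s) \<cdot> e j = y \<cdot> k j" "\<Z> S Y \<cdot> e j = \<Z> (K j) Y" if "j \<in> J" for j
      using comp_assoc[OF coproduct_hom[OF S that] s(1) y] s(2)[OF that]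
        zero_comp[OF coproduct_hom[OF S that] YO] by auto
    show ?thesis
      using coproduct_eqI[OF S comp_hom[OF s(1) y] zero_hom[OF SO YO]] 1 by metis
  qed
  obtain q where q: "is_cokernel q s" using ex_cokernel Hom_ends[OF s(1)] by blast
  obtain Q where qh: "q \<in> Hom A Q" and qs: "q \<cdot> s = \<Z> S Q" using cokernel_hom[OF q s(1)] .
  have "\<exists>l. l \<in> Hom (D j) Q \<and> l \<cdot> c j = q" if "j \<in> J" for j
    using cokernel_factor[OF c(1) c(2) k(2) qh] kill[OF qh] qs that by metis
  then obtain l1 where l1: "\<And>j. j \<in> J \<Longrightarrow> l1 j \<in> Hom (D j) Q" "\<And>j. j \<in> J \<Longrightarrow> l1 j \<cdot> c j = q"
    by metis
  have QO: "Q \<in> Obj C" using Hom_obj qh by blast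
  have lim1: "direct_limit J r D a1 Q l1"
    unfolding direct_limit_def
  proof (intro conjI allI impI)
    have "l1 j \<cdot> a1 i j = l1 i" if r: "(i, j) \<in> r" for i j
    proof -
      have ij: "i \<in> J" "j \<in> J" using rJ r by blast+
      have "(l1 j \<cdot> a1 i j) \<cdot> c i = l1 i \<cdot> c i"
        using comp_assoc[OF c(2) a1(1) l1(1)] a1(2) l1(2) ij r by metis
      then show ?thesis
        using epi_arrD[OF epi_c c(2) comp_hom[OF a1(1) l1(1)] l1(1)] ij r by metis
    qed
    then show "cocone J r D a1 Q l1" unfolding cocone_def using QO l1 by blast
    fix Y y assume co: "cocone J r D a1 Y y"
    then have y: "\<And>j. j \<in> J \<Longrightarrow> y j \<in> Hom (D j) Y" "\<And>i j. (i, j) \<in> r \<Longrightarrow> y j \<cdot> a1 i j = y i"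
      unfolding cocone_def by blast+
    \<comment> \<open>By directedness the composites \<open>y j \<cdot> c j\<close> all coincide.
      Their common value \<open>z\<close> kills every \<open>k j\<close> and hence factors through
      \<open>q\<close>.\<close>
    have step: "y i \<cdot> c i = y j \<cdot> c j" if r: "(i, j) \<in> r" for i j
      using comp_assoc[OF c(2) a1(1) y(1)] a1(2) y(2) r rJ[OF r] by metis
    have const: "y i \<cdot> c i = y j \<cdot> c j" if "i \<in> J" "j \<in> J" for i j
      using up[OF that] step by metis
    obtain n where n: "n \<in> J" using ne by blast
    define z where "z = y n \<cdot> c n"
    have z: "z \<in> Hom A Y" "\<And>j. j \<in> J \<Longrightarrow> y j \<cdot> c j = z"
      unfolding z_def using const n comp_hom[OF c(2) y(1)] by blast+
    have "z \<cdot> k j = \<Z> (K j) Y" if j: "j \<in> J" for j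
      using comp_assoc[OF k(2) c(2) y(1)] z(2) ck0 comp_zero[OF y(1)] Hom_obj[OF k(2)] j by metis
    then obtain h where h: "h \<in> Hom Q Y" "h \<cdot> q = z"
      using cokernel_factor[OF q qh s(1) z(1)] kill[OF z(1)] by blast
    have "h' \<cdot> l1 j = y j \<longleftrightarrow> h' \<cdot> q = z" if h': "h' \<in> Hom Q Y" and j: "j \<in> J" for h' j
      using epi_arrD[OF epi_c[OF j] c(2)[OF j] comp_hom[OF l1(1)[OF j] h'] y(1)[OF j]]
        comp_assoc[OF c(2)[OF j] l1(1)[OF j] h'] l1(2)[OF j] z(2)[OF j] by metis
    then show "\<exists>!h. h \<in> Hom Q Y \<and> (\<forall>i\<in>J. h \<cdot> l1 i = y i)"
      using h n epi_arrD[OF cokernel_epi[OF q] qh] by (metis (no_types, lifting))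
  qed

  have QZ: "\<Z> Q Z \<in> Hom Q Z" and ZZ: "\<Z> Z Z \<in> Hom Z Z" using zero_hom QO ZO by blast+
  \<comment> \<open>AB5 makes the zero morphism from \<open>Q\<close> a kernel. This forces
    \<open>q\<close> to vanish, and \<open>x\<close> with it, since \<open>x\<close> factors through
    \<open>q\<close>.\<close>
  have "short_exact (\<Z> Q Z) (\<Z> Z Z)"
  proof (rule direct_limits_exact[OF JU dir sys1 sys2 sys3 _ _ _ lim1 lim2 lim3 QZ _ ZZ])
    show "system_map J r D a1 (\<lambda>_. B) a2 m"
      unfolding system_map_def using m(1) a2m by blast
    show "system_map J r (\<lambda>_. B) a2 E a3 d"
      unfolding system_map_def using md(2) a3(2) by metis
    show "\<Z> Q Z \<cdot> l1 i = \<Z> B Z \<cdot> m i" if "i \<in> J" for i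
      using zero_comp[OF l1(1)[OF that] ZO] zero_comp[OF m(1)[OF that] ZO] by simp
    show "\<Z> Z Z \<cdot> \<Z> B Z = \<Z> (E i) Z \<cdot> d i" if "i \<in> J" for i
      using comp_zero[OF ZZ B] zero_comp[OF md(2)[OF that] ZO] by simp
  qed (use md(1) in blast)
  then have "q = \<Z> A Q" using zero_monoD[OF _ qh ZO] unfolding short_exact_def by blast
  moreover obtain x' where "x' \<in> Hom Q X" "x' \<cdot> q = x"
    using cokernel_factor[OF q qh s(1) x] kill[OF x] xk by blast
  ultimately show ?thesis using comp_zero A by metis
qed

section \<open>Small sets and the universe\<close>

text \<open>Index sets of coproducts and direct limits have to be subsets of \<open>U\<close>; a
  small set of any other type, such as a set of subsets, is replaced by a copy inside
  \<open>U\<close>.\<close>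

lemma small_embedding:
  assumes "small U X"
  obtains f where "inj_on f X" "f ` X \<subseteq> U" "small U (f ` X)"
proof -
  obtain f where "inj_on f X" "f ` X \<subseteq> U"
    using card_of_ordLeq[of X U] ordLess_imp_ordLeq assms unfolding small_def by blast
  moreover have "small U (f ` X)"
    using card_of_image ordLeq_ordLess_trans assms unfolding small_def by blast
  ultimately show thesis using that by blast
qed

text \<open>\<open>W\<close> is a copy of the disjoint union of \<open>H\<close> with the natural
  numbers: the second summand makes it infinite, and the union stays small because \<open>U\<close>
  is infinite.\<close>

lemma universe_infinite_bound:
  assumes U: "universe U" and H: "small U H"
  obtains W where "W \<subseteq> U" "small U W" "infinite W" "|H| \<le>o |W|"
proof -
  let ?X = "(UNIV :: nat set) <+> H"
  have nat: "|UNIV :: nat set| <o |U|" using U unfolding universe_def by blast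
  then have "infinite U"
    using ordLess_imp_ordLeq card_of_ordLeq_infinite infinite_UNIV_nat by blast
  then have "small U ?X"
    using card_of_Plus_ordLess_infinite nat H unfolding small_def by blast
  then obtain f :: "nat + _ \<Rightarrow> _" where f: "inj_on f ?X" "f ` ?X \<subseteq> U" "small U (f ` ?X)"
    using small_embedding by blast
  have "|?X| \<le>o |f ` ?X|"
    using f(1) by (rule card_of_ordLeqI) (rule imageI)
  then have "|H| \<le>o |f ` ?X|"
    by (rule ordLeq_transitive[OF card_of_Plus2])
  moreover have "infinite (f ` ?X)"
    using finite_imageD[OF _ f(1)] finite_PlusD(1) infinite_UNIV_nat by blast
  ultimately show thesis using that f by blast
qed

lemma universe_small_Pow:
  "\<lbrakk>universe U; X \<subseteq> U; small U X\<rbrakk> \<Longrightarrow> small U (Pow X)"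
  unfolding universe_def small_def by blast

section \<open>Supports of morphisms into an infinite coproduct\<close>

text \<open>Deleting the summands indexed by a finite set \<open>T\<close> is an endomorphism
  \<open>R T\<close> of \<open>B\<close>, and the kernel of \<open>R T \<cdot> y\<close> is the part
  of \<open>A\<close> on which \<open>y\<close> has no components outside \<open>T\<close>. By
  \<open>kernels_jointly_epi\<close> a nonzero \<open>x\<close> stays nonzero on one of these
  kernels, and the generator then supplies a morphism into that kernel on which \<open>x\<close> is
  still nonzero.\<close>

lemma (in grothendieck_category) detect_finite_support:
  assumes U: "universe U" and IU: "I \<subseteq> U" "small U I" "infinite I"
    and S: "is_coproduct I F B e" and gen: "generator G"
    and p: "\<And>i. i \<in> I \<Longrightarrow> p i \<in> Hom B (F i)"
      "\<And>i j. \<lbrakk>i \<in> I; j \<in> I; i \<noteq> j\<rbrakk> \<Longrightarrow> p i \<cdot> e j = \<Z> (F j) (F i)"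
    and y: "y \<in> Hom A B" and x: "x \<in> Hom A X" "x \<noteq> \<Z> A X"
  shows "\<exists>h\<in>Hom G A. x \<cdot> h \<noteq> \<Z> G X \<and> finite {i \<in> I. p i \<cdot> y \<cdot> h \<noteq> \<Z> G (F i)}"
proof -
  note e = coproduct_hom[OF S]
  have B: "B \<in> Obj C" and A: "A \<in> Obj C" and X: "X \<in> Obj C" and G: "G \<in> Obj C" and F: "\<And>i. i \<in> I \<Longrightarrow> F i \<in> Obj C"
    using Hom_obj y x(1) e gen unfolding generator_def by blast+
  have "\<exists>r. r \<in> Hom B B \<and> (\<forall>i\<in>I. r \<cdot> e i = (if i \<in> T then \<Z> (F i) B else e i))" for T
    using coproduct_induced[OF S B, of "\<lambda>i. if i \<in> T then \<Z> (F i) B else e i"] zero_hom[OF F B] e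
    by (smt (verit))
  then obtain R where R: "\<And>T. R T \<in> Hom B B"
      "\<And>T i. i \<in> I \<Longrightarrow> R T \<cdot> e i = (if i \<in> T then \<Z> (F i) B else e i)"
    by metis
  have RR: "R T' \<cdot> R T = R T'" if "T \<subseteq> T'" for T T'
  proof (rule coproduct_eqI[OF S comp_hom[OF R(1) R(1)] R(1)])
    fix i assume i: "i \<in> I"
    show "(R T' \<cdot> R T) \<cdot> e i = R T' \<cdot> e i"
      using comp_assoc[OF e[OF i] R(1) R(1)] R(2)[OF i] that comp_zero[OF R(1) F[OF i]] by auto
  qed
  \<comment> \<open>Projections outside \<open>T\<close> do not notice the deletion, so whatever
    \<open>R T\<close> kills has no component outside \<open>T\<close>.\<close>
  have pR: "p i \<cdot> R T = p i" if i: "i \<in> I" "i \<notin> T" for i T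
  proof (rule coproduct_eqI[OF S comp_hom[OF R(1) p(1)] p(1)])
    fix j assume j: "j \<in> I"
    show "(p i \<cdot> R T) \<cdot> e j = p i \<cdot> e j"
      using comp_assoc[OF e[OF j] R(1) p(1)[OF i(1)]] R(2)[OF j] i p(2)[OF i(1) j]
        comp_zero[OF p(1)[OF i(1)] F[OF j]] by (cases "i = j") auto
  qed (use i in auto)

  \<comment> \<open>The finite subsets of \<open>I\<close>, ordered by inclusion, form the directed
    index set. \<open>J\<close> is a copy of them in \<open>U\<close>, small because
    \<open>Pow I\<close> is, and \<open>\<phi>\<close> decodes an index into its finite set;
    injectivity of \<open>\<phi>\<close> gives antisymmetry.\<close>
  have "Fpow I \<subseteq> Pow I" by (auto simp: Fpow_def)
  then have "small U (Fpow I)"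
    using card_of_mono1 ordLeq_ordLess_trans universe_small_Pow[OF U IU(1,2)] unfolding small_def by blast
  then obtain g where g: "inj_on g (Fpow I)" "g ` Fpow I \<subseteq> U" "small U (g ` Fpow I)"
    using small_embedding by blast
  define J where "J = g ` Fpow I"
  define \<phi> where "\<phi> = inv_into (Fpow I) g"
  define r where "r = {(i, j) \<in> J \<times> J. \<phi> i \<subseteq> \<phi> j}"
  have \<phi>: "finite (\<phi> j)" "\<phi> j \<subseteq> I" if "j \<in> J" for j
    using inv_into_into[of j g "Fpow I"] that by (auto simp: \<phi>_def J_def Fpow_def)
  have \<phi>_surj: "\<exists>j\<in>J. \<phi> j = T" if "finite T" "T \<subseteq> I" for T
    using inv_into_f_f[OF g(1), of T] that by (auto simp: \<phi>_def J_def Fpow_def)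
  have "inj_on \<phi> J"
    unfolding \<phi>_def J_def by (rule inj_on_inv_into) simp
  then have anti: "antisym r"
    by (auto simp: r_def antisym_def dest: inj_onD)
  have dir: "directed_preorder J r"
    unfolding directed_preorder_def
  proof (intro conjI ballI)
    show "preorder_on J r"
      by (auto simp: preorder_on_def refl_on_def r_def intro!: transI)
    show "J \<noteq> {}" using Fpow_not_empty by (auto simp: J_def)
    fix i j assume "i \<in> J" "j \<in> J"
    then show "\<exists>k\<in>J. (i, k) \<in> r \<and> (j, k) \<in> r"
      using \<phi>_surj[of "\<phi> i \<union> \<phi> j"] \<phi> by (auto simp: r_def)
  qed

  define k where "k j = (SOME k. is_kernel k (R (\<phi> j) \<cdot> y))" for j
  have Ry: "R T \<cdot> y \<in> Hom A B" for T using comp_hom[OF y R(1)] .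
  have k: "is_kernel (k j) (R (\<phi> j) \<cdot> y)" for j
    using ex_kernel[OF Hom_ends(1)[OF Ry]] unfolding k_def by (rule someI_ex)
  have kh: "k j \<in> Hom (Dom C (k j)) A" for j
    using kernel_hom[OF k Ry] Hom_ends(2) by metis
  have "\<exists>j\<in>J. x \<cdot> k j \<noteq> \<Z> (Dom C (k j)) X"
  proof (rule ccontr)
    assume neg: "\<not> ?thesis"
    have "x = \<Z> A X"
    proof (rule kernels_jointly_epi[OF _ _ dir _ _ anti _ y x(1) k kh])
      show "J \<subseteq> U" "small U J" using g unfolding J_def by blast+
      show "R (\<phi> j) \<cdot> R (\<phi> i) = R (\<phi> j)" if "(i, j) \<in> r" for i j
        using that RR by (auto simp: r_def)
      show "x \<cdot> k j = \<Z> (Dom C (k j)) X" if "j \<in> J" for j using neg that by blast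
      fix Y l n
      assume n: "n \<in> J" and l: "\<And>j. j \<in> J \<Longrightarrow> l j \<in> Hom B Y"
        and lR: "\<And>i j. (i, j) \<in> r \<Longrightarrow> i \<noteq> j \<Longrightarrow> l j \<cdot> R (\<phi> j) = l i"
      have Y: "Y \<in> Obj C" using Hom_obj l n by blast
      show "l n = \<Z> B Y"
      proof (rule coproduct_eqI[OF S l[OF n] zero_hom[OF B Y]])
        fix i assume i: "i \<in> I"
        \<comment> \<open>Adding \<open>i\<close> makes \<open>R (\<phi> j)\<close> kill
          \<open>e i\<close>. The further element \<open>i'\<close>, available because
          \<open>I\<close> is infinite, guarantees \<open>j \<noteq> n\<close> even when
          \<open>i\<close> already lies in \<open>\<phi> n\<close>; the relation \<open>lR\<close>
          is given only off the diagonal.\<close>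
        obtain i' where i': "i' \<in> I" "i' \<notin> \<phi> n"
          using infinite_imp_nonempty[OF Diff_infinite_finite[OF \<phi>(1)[OF n] IU(3)]] by blast
        obtain j where j: "j \<in> J" "\<phi> j = insert i (insert i' (\<phi> n))"
          using \<phi>_surj[of "insert i (insert i' (\<phi> n))"] \<phi>[OF n] i i' by auto
        have "(n, j) \<in> r" "n \<noteq> j" using j i' n by (auto simp: r_def)
        then have "l n \<cdot> e i = (l j \<cdot> R (\<phi> j)) \<cdot> e i" using lR by simp
        also have "\<dots> = \<Z> (F i) Y"
          using comp_assoc[OF e[OF i] R(1) l[OF j(1)]] R(2)[OF i] j comp_zero[OF l[OF j(1)] F[OF i]] by simp
        finally show "l n \<cdot> e i = \<Z> B Y \<cdot> e i" using zero_comp[OF e[OF i] Y] by simp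
      qed
    qed (use R in auto)
    then show False using x by blast
  qed
  then obtain j where j: "j \<in> J" "x \<cdot> k j \<noteq> \<Z> (Dom C (k j)) X" by blast
  define K where "K = Dom C (k j)"
  have kj: "k j \<in> Hom K A" using kh unfolding K_def .
  have KO: "K \<in> Obj C" using Hom_obj kj by blast
  obtain t where t: "t \<in> Hom G K" "(x \<cdot> k j) \<cdot> t \<noteq> \<Z> K X \<cdot> t"
    using gen j(2) comp_hom[OF kj x(1)] zero_hom[OF KO X] KO X unfolding generator_def K_def by blast
  define h where "h = k j \<cdot> t"
  have h: "h \<in> Hom G A" unfolding h_def using comp_hom[OF t(1) kj] .
  have xh: "x \<cdot> h \<noteq> \<Z> G X"
    using comp_assoc[OF t(1) kj x(1)] t(2) zero_comp[OF t(1) X] by (simp add: h_def)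
  have "(R (\<phi> j) \<cdot> y) \<cdot> k j = \<Z> K B"
    using kernel_hom[OF k Ry, of j] Hom_ends(2)[OF kj] Hom_ends(2) by metis
  then have "(R (\<phi> j) \<cdot> y) \<cdot> h = \<Z> G B"
    using comp_assoc[OF t(1) kj Ry] zero_comp[OF t(1) B] unfolding h_def by metis
  then have Ryh: "R (\<phi> j) \<cdot> y \<cdot> h = \<Z> G B"
    using comp_assoc[OF h y R(1)] by simp
  have "p i \<cdot> y \<cdot> h = \<Z> G (F i)" if i: "i \<in> I" "i \<notin> \<phi> j" for i
    using comp_assoc[OF comp_hom[OF h y] R(1) p(1)[OF i(1)]] pR[OF i] Ryh comp_zero[OF p(1)[OF i(1)] G] by metis
  then have "{i \<in> I. p i \<cdot> y \<cdot> h \<noteq> \<Z> G (F i)} \<subseteq> \<phi> j" by blast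
  then show ?thesis using finite_subset[OF _ \<phi>(1)[OF j(1)]] h xh by blast
qed

text \<open>Each nonzero component of \<open>y\<close> remains nonzero after some \<open>h\<close>
  from \<open>G\<close> for which \<open>y \<cdot> h\<close> has finite support. The support of
  \<open>y\<close> is thus covered by at most \<open>|Hom G A|\<close> finite sets, and
  \<open>W\<close> is infinite.\<close>

lemma (in grothendieck_category) support_bound:
  assumes U: "universe U" and IU: "I \<subseteq> U" "small U I" "infinite I"
    and S: "is_coproduct I F B e" and gen: "generator G"
    and p: "\<And>i. i \<in> I \<Longrightarrow> p i \<in> Hom B (F i)"
      "\<And>i j. \<lbrakk>i \<in> I; j \<in> I; i \<noteq> j\<rbrakk> \<Longrightarrow> p i \<cdot> e j = \<Z> (F j) (F i)"
    and y: "y \<in> Hom A B" and W: "infinite W" "|Hom G A| \<le>o |W|"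
  shows "|{i \<in> I. p i \<cdot> y \<noteq> \<Z> A (F i)}| \<le>o |W|"
proof -
  define T where "T h = {i \<in> I. p i \<cdot> y \<cdot> h \<noteq> \<Z> G (F i)}" for h
  define H where "H = {h \<in> Hom G A. finite (T h)}"
  have "{i \<in> I. p i \<cdot> y \<noteq> \<Z> A (F i)} \<subseteq> (\<Union>h\<in>H. T h)"
  proof
    fix i assume "i \<in> {i \<in> I. p i \<cdot> y \<noteq> \<Z> A (F i)}"
    then have i: "i \<in> I" "p i \<cdot> y \<noteq> \<Z> A (F i)" by auto
    \<comment> \<open>The nonzero morphism to be detected is the component
      \<open>p i \<cdot> y\<close> itself, which places \<open>i\<close> in
      \<open>T h\<close>.\<close>
    obtain h where h: "h \<in> Hom G A" "(p i \<cdot> y) \<cdot> h \<noteq> \<Z> G (F i)" "finite (T h)"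
      using detect_finite_support[OF U IU S gen p y comp_hom[OF y p(1)[OF i(1)]] i(2)]
      unfolding T_def by blast
    then show "i \<in> (\<Union>h\<in>H. T h)"
      using comp_assoc[OF h(1) y p(1)[OF i(1)]] i(1) by (auto simp: H_def T_def)
  qed
  then have "|{i \<in> I. p i \<cdot> y \<noteq> \<Z> A (F i)}| \<le>o |\<Union>h\<in>H. T h|" by (rule card_of_mono1)
  also have "|\<Union>h\<in>H. T h| \<le>o |W|"
  proof (rule card_of_UNION_ordLeq_infinite[OF W(1)])
    show "|H| \<le>o |W|"
      using card_of_mono1[of H "Hom G A"] W(2) ordLeq_transitive by (auto simp: H_def)
    show "\<forall>h\<in>H. |T h| \<le>o |W|"
      using W(1) finite_ordLess_infinite[OF card_of_Well_order card_of_Well_order] ordLess_imp_ordLeq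
      by (auto simp: H_def Field_card_of)
  qed
  finally show ?thesis .
qed

section \<open>Ideals, and the ideal of morphisms with few components outside
  \<open>M\<close>\<close>

context preadditive_category
begin

lemma ideal_subgroup:
  assumes "ideal M" "A \<in> Obj C" "B \<in> Obj C"
  shows "subgroup (M A B) (Hom_group C A B)"
  using assms unfolding ideal_def by blast

lemma ideal_hom: "\<lbrakk>ideal M; A \<in> Obj C; B \<in> Obj C; f \<in> M A B\<rbrakk> \<Longrightarrow> f \<in> Hom A B"
  using subgroup.subset[OF ideal_subgroup] Hom_group_simps(1) by blast

lemma ideal_zero: "\<lbrakk>ideal M; A \<in> Obj C; B \<in> Obj C\<rbrakk> \<Longrightarrow> \<Z> A B \<in> M A B"
  using subgroup.one_closed[OF ideal_subgroup] by (simp add: Hom_group_simps)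

lemma ideal_plus:
  "\<lbrakk>ideal M; A \<in> Obj C; B \<in> Obj C; f \<in> M A B; g \<in> M A B\<rbrakk> \<Longrightarrow> f \<^bold>+ g \<in> M A B"
  using subgroup.m_closed[OF ideal_subgroup] by (metis Hom_group_simps(2))

text \<open>\<open>f\<close> is the sum minus \<open>g\<close>. Applied to a sum equal to zero, this
  yields closure under negatives below.\<close>

lemma ideal_left_summand:
  assumes M: "ideal M" and f: "f \<in> Hom A B" and g: "g \<in> M A B" and sum: "f \<^bold>+ g \<in> M A B"
  shows "f \<in> M A B"
proof -
  have AB: "A \<in> Obj C" "B \<in> Obj C" using Hom_obj f by blast+
  interpret group "Hom_group C A B" using hom_group AB .
  interpret M: subgroup "M A B" "Hom_group C A B" using ideal_subgroup M AB .
  have "f = (f \<otimes>\<^bsub>Hom_group C A B\<^esub> g) \<otimes>\<^bsub>Hom_group C A B\<^esub> inv\<^bsub>Hom_group C A B\<^esub> g"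
    using inv_solve_right[of f "f \<otimes>\<^bsub>Hom_group C A B\<^esub> g" g] f g M.mem_carrier M.m_closed sum
    by (simp add: Hom_group_simps)
  then show ?thesis using M.m_closed M.m_inv_closed sum g by (metis Hom_group_simps(2))
qed

lemma ideal_comp:
  assumes M: "ideal M" and AB: "A \<in> Obj C" "B \<in> Obj C" and m: "m \<in> M A B"
  shows "f \<in> Hom X A \<Longrightarrow> m \<cdot> f \<in> M X B" "g \<in> Hom B Y \<Longrightarrow> g \<cdot> m \<in> M A Y"
proof -
  have mh: "m \<in> Hom A B" using ideal_hom M AB m .
  have *: "g \<cdot> m \<cdot> f \<in> M X Y" if "f \<in> Hom X A" "g \<in> Hom B Y" for f g X Y
    using M m that Hom_obj[OF that(1)] Hom_obj[OF that(2)] unfolding ideal_def by blast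
  show "m \<cdot> f \<in> M X B" if "f \<in> Hom X A"
    using *[OF that ident_hom[OF AB(2)]] ident_comp[OF comp_hom[OF that mh]] by simp
  show "g \<cdot> m \<in> M A Y" if "g \<in> Hom B Y"
    using *[OF ident_hom[OF AB(1)] that] comp_ident[OF mh] by simp
qed

text \<open>An ideal containing the identity of \<open>A\<close> contains every morphism out of
  \<open>A\<close>.\<close>

lemma proper_ideal_ident:
  assumes "proper_ideal M"
  obtains A where "A \<in> Obj C" "\<I> A \<notin> M A A"
proof -
  obtain A B where M: "ideal M" and AB: "A \<in> Obj C" "B \<in> Obj C" and ne: "M A B \<noteq> Hom A B"
    using assms unfolding proper_ideal_def by blast
  then obtain f where f: "f \<in> Hom A B" "f \<notin> M A B" using ideal_hom by blast
  have "\<I> A \<notin> M A A"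
    using ideal_comp(2)[OF M AB(1) AB(1) _ f(1)] comp_ident f by metis
  then show thesis using that AB by blast
qed

text \<open>A component of a sum lies outside \<open>M\<close> only if a component of a summand
  does, and a union of two sets of size at most \<open>|W|\<close> is again that small.
  Precomposition preserves \<open>M\<close>; postcomposition by \<open>g\<close> replaces the test
  morphism \<open>y\<close> by \<open>y \<cdot> g\<close>, which is why the condition ranges over
  all \<open>y\<close>.\<close>

lemma ideal_few_components:
  assumes M: "ideal M" and A: "A \<in> Obj C" and p: "\<And>i. i \<in> I \<Longrightarrow> p i \<in> Hom B A" and W: "infinite W"
  shows "ideal (\<lambda>X Y. {f \<in> Hom X Y. \<forall>y\<in>Hom Y B. |{i \<in> I. p i \<cdot> y \<cdot> f \<notin> M X A}| \<le>o |W|})"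
    (is "ideal ?J")
  unfolding ideal_def
proof (intro conjI ballI)
  have mono: "|S| \<le>o |W|" if "|T| \<le>o |W|" "S \<subseteq> T" for S T
    using card_of_mono1[OF that(2)] that(1) ordLeq_transitive by blast
  fix X Y assume XY: "X \<in> Obj C" "Y \<in> Obj C"
  interpret group "Hom_group C X Y" using hom_group XY .
  show "subgroup (?J X Y) (Hom_group C X Y)"
  proof (rule subgroupI)
    show "?J X Y \<subseteq> carrier (Hom_group C X Y)" by (auto simp: Hom_group_simps)
    have "p i \<cdot> y \<cdot> \<Z> X Y \<in> M X A" if "i \<in> I" "y \<in> Hom Y B" for i y
      using comp_zero[OF that(2) XY(1)] comp_zero[OF p[OF that(1)] XY(1)] ideal_zero[OF M XY(1) A] by simp
    then have "{i \<in> I. p i \<cdot> y \<cdot> \<Z> X Y \<notin> M X A} = {}" if "y \<in> Hom Y B" for y using that by blast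
    then have "|{i \<in> I. p i \<cdot> y \<cdot> \<Z> X Y \<notin> M X A}| \<le>o |W|" if "y \<in> Hom Y B" for y
      by (simp only: that card_of_empty)
    then have "\<Z> X Y \<in> ?J X Y" using zero_hom[OF XY] by blast
    then show "?J X Y \<noteq> {}" by blast
    fix f assume f: "f \<in> ?J X Y"
    then have fh: "f \<in> Hom X Y" by blast
    define f' where "f' = m_inv (Hom_group C X Y) f"
    have f': "f' \<in> Hom X Y" "f' \<^bold>+ f = \<Z> X Y"
      using fh inv_closed[of f] l_inv[of f] by (auto simp: f'_def Hom_group_simps)
    have "p i \<cdot> y \<cdot> f' \<in> M X A" if y: "y \<in> Hom Y B" and i: "i \<in> I" and m: "p i \<cdot> y \<cdot> f \<in> M X A" for y i
    proof (rule ideal_left_summand[OF M _ m])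
      show "p i \<cdot> y \<cdot> f' \<in> Hom X A" using comp_hom[OF comp_hom[OF f'(1) y] p[OF i]] .
      have "p i \<cdot> y \<cdot> f' \<^bold>+ p i \<cdot> y \<cdot> f = \<Z> X A"
        using comp_plus_right[OF f'(1) fh y] comp_plus_right[OF comp_hom[OF f'(1) y] comp_hom[OF fh y] p[OF i]]
          f'(2) comp_zero[OF y XY(1)] comp_zero[OF p[OF i] XY(1)] by simp
      then show "p i \<cdot> y \<cdot> f' \<^bold>+ p i \<cdot> y \<cdot> f \<in> M X A" using ideal_zero[OF M XY(1) A] by simp
    qed
    then have *: "{i \<in> I. p i \<cdot> y \<cdot> f' \<notin> M X A} \<subseteq> {i \<in> I. p i \<cdot> y \<cdot> f \<notin> M X A}" if "y \<in> Hom Y B" for y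
      using that by blast
    then show "m_inv (Hom_group C X Y) f \<in> ?J X Y"
      using f f'(1) mono[OF _ *] unfolding f'_def by blast
    fix g assume g: "g \<in> ?J X Y"
    then have gh: "g \<in> Hom X Y" by blast
    have **: "{i \<in> I. p i \<cdot> y \<cdot> (f \<^bold>+ g) \<notin> M X A} \<subseteq>
        {i \<in> I. p i \<cdot> y \<cdot> f \<notin> M X A} \<union> {i \<in> I. p i \<cdot> y \<cdot> g \<notin> M X A}" if y: "y \<in> Hom Y B" for y
      using comp_plus_right[OF fh gh y] comp_plus_right[OF comp_hom[OF fh y] comp_hom[OF gh y] p]
        ideal_plus[OF M XY(1) A] by auto
    have "|{i \<in> I. p i \<cdot> y \<cdot> f \<notin> M X A} \<union> {i \<in> I. p i \<cdot> y \<cdot> g \<notin> M X A}| \<le>o |W|" if "y \<in> Hom Y B" for y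
      using f g that W card_of_Un_ordLeq_infinite_Field[of "|W|", unfolded Field_card_of, OF _ _ _ card_of_card_order_on]
      by blast
    then show "f \<otimes>\<^bsub>Hom_group C X Y\<^esub> g \<in> ?J X Y"
      using plus_hom[OF fh gh] mono[OF _ **] by (auto simp: Hom_group_simps)
  qed
next
  fix X Y V Z f j g
  assume O: "X \<in> Obj C" "Y \<in> Obj C" "V \<in> Obj C" "Z \<in> Obj C"
    and f: "f \<in> Hom X Y" and j: "j \<in> ?J Y V" and g: "g \<in> Hom V Z"
  then have jh: "j \<in> Hom Y V" by blast
  have "|{i \<in> I. p i \<cdot> y \<cdot> g \<cdot> j \<cdot> f \<notin> M X A}| \<le>o |W|" if y: "y \<in> Hom Z B" for y
  proof -
    have eq: "p i \<cdot> y \<cdot> g \<cdot> j \<cdot> f = (p i \<cdot> (y \<cdot> g) \<cdot> j) \<cdot> f" if "i \<in> I" for i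
      using comp_assoc[OF comp_hom[OF f jh] g y] comp_assoc[OF f jh comp_hom[OF g y]]
        comp_assoc[OF f comp_hom[OF jh comp_hom[OF g y]] p[OF that]] by simp
    have "{i \<in> I. p i \<cdot> y \<cdot> g \<cdot> j \<cdot> f \<notin> M X A} \<subseteq> {i \<in> I. p i \<cdot> (y \<cdot> g) \<cdot> j \<notin> M Y A}"
      using eq ideal_comp(1)[OF M O(2) A _ f] by auto
    moreover have "|{i \<in> I. p i \<cdot> (y \<cdot> g) \<cdot> j \<notin> M Y A}| \<le>o |W|"
      using j comp_hom[OF g y] by blast
    ultimately show ?thesis using card_of_mono1 ordLeq_transitive by blast
  qed
  then show "g \<cdot> j \<cdot> f \<in> ?J X Z" using comp_hom[OF comp_hom[OF f jh] g] by blast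
qed

end

section \<open>A strictly larger proper ideal\<close>

theorem (in grothendieck_category) no_maximal_ideal:
  assumes U: "universe U"
  shows "\<not> maximal_ideal M"
proof
  assume max: "maximal_ideal M"
  then have pM: "proper_ideal M" unfolding maximal_ideal_def by blast
  then have M: "ideal M" unfolding proper_ideal_def by blast
  obtain A where A: "A \<in> Obj C" "\<I> A \<notin> M A A" using proper_ideal_ident[OF pM] .
  obtain G where gen: "generator G" using ex_generator by blast
  then have G: "G \<in> Obj C" unfolding generator_def by blast
  obtain W where W: "W \<subseteq> U" "small U W" "infinite W" "|Hom G A| \<le>o |W|"
    using universe_infinite_bound[OF U locally_small[OF G A(1)]] by blast
  \<comment> \<open>The index set is a copy of \<open>Pow W\<close>: larger than \<open>W\<close> by
    Cantor's theorem, yet small because \<open>U\<close> is inaccessible.\<close>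
  obtain g where g: "inj_on g (Pow W)" "g ` Pow W \<subseteq> U" "small U (g ` Pow W)"
    using small_embedding universe_small_Pow[OF U W(1,2)] by blast
  define I where "I = g ` Pow W"
  have IU: "I \<subseteq> U" "small U I" using g unfolding I_def by blast+
  have "|Pow W| \<le>o |I|" unfolding I_def using g(1) by (rule card_of_ordLeqI) (rule imageI)
  then have WI: "|W| <o |I|" using card_of_Pow ordLess_ordLeq_trans by blast
  then have inf: "infinite I" using W(3) card_of_ordLeq_infinite ordLess_imp_ordLeq by blast
  obtain B e where S: "is_coproduct I (\<lambda>_. A) B e"
    using ex_coproduct[OF IU, of "\<lambda>_. A"] A(1) by blast
  have B: "B \<in> Obj C" using S unfolding is_coproduct_def by blast
  have "\<exists>p. p \<in> Hom B A \<and> (\<forall>j\<in>I. p \<cdot> e j = (if j = i then \<I> A else \<Z> A A))" for i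
    using coproduct_induced[OF S A(1), of "\<lambda>j. if j = i then \<I> A else \<Z> A A"]
      ident_hom[OF A(1)] zero_hom[OF A(1) A(1)] by (smt (verit))
  then obtain p where p: "\<And>i. p i \<in> Hom B A"
      "\<And>i j. j \<in> I \<Longrightarrow> p i \<cdot> e j = (if j = i then \<I> A else \<Z> A A)"
    by metis
  define J where "J X Y = {f \<in> Hom X Y. \<forall>y\<in>Hom Y B. |{i \<in> I. p i \<cdot> y \<cdot> f \<notin> M X A}| \<le>o |W|}" for X Y
  have J: "ideal J" unfolding J_def using ideal_few_components[OF M A(1) p(1) W(3)] .
  have "ideal_le M J"
    unfolding ideal_le_def
  proof (intro ballI subsetI)
    fix X Y f assume XY: "X \<in> Obj C" "Y \<in> Obj C" and f: "f \<in> M X Y"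
    have "{i \<in> I. p i \<cdot> y \<cdot> f \<notin> M X A} = {}" if y: "y \<in> Hom Y B" for y
      using ideal_comp(2)[OF M XY(1) B ideal_comp(2)[OF M XY f y] p(1)] by blast
    then have "|{i \<in> I. p i \<cdot> y \<cdot> f \<notin> M X A}| \<le>o |W|" if "y \<in> Hom Y B" for y
      by (simp only: that card_of_empty)
    then show "f \<in> J X Y" using ideal_hom[OF M XY f] unfolding J_def by blast
  qed
  moreover have "\<not> ideal_le J M"
  proof -
    \<comment> \<open>Components outside \<open>M\<close> are in particular nonzero, so the bound on
      the support of \<open>y\<close> applies.\<close>
    have "|{i \<in> I. p i \<cdot> y \<cdot> \<I> A \<notin> M A A}| \<le>o |W|" if y: "y \<in> Hom A B" for y
    proof -
      have "{i \<in> I. p i \<cdot> y \<cdot> \<I> A \<notin> M A A} \<subseteq> {i \<in> I. p i \<cdot> y \<noteq> \<Z> A A}"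
        using comp_ident[OF y] ideal_zero[OF M A(1) A(1)] by auto
      moreover have "|{i \<in> I. p i \<cdot> y \<noteq> \<Z> A A}| \<le>o |W|"
        using support_bound[OF U IU inf S gen p(1) _ y W(3,4)] p(2) by simp
      ultimately show ?thesis using card_of_mono1 ordLeq_transitive by blast
    qed
    then have "\<I> A \<in> J A A" unfolding J_def using ident_hom[OF A(1)] by blast
    then show ?thesis using A unfolding ideal_le_def by blast
  qed
  moreover have "proper_ideal J"
  proof -
    \<comment> \<open>Composing \<open>p i\<close> with the injection \<open>e i\<close> gives the
      identity of \<open>A\<close>, which is not in \<open>M\<close>. With the identity of
      \<open>B\<close> as test morphism, all \<open>|I|\<close> components therefore lie outside
      \<open>M\<close>, more than \<open>|W|\<close> allows.\<close>
    have "p i \<notin> M B A" if "i \<in> I" for i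
      using ideal_comp(1)[OF M B A(1) _ coproduct_hom[OF S that]] p(2)[OF that, of i] A(2) by metis
    then have "{i \<in> I. p i \<cdot> \<I> B \<cdot> \<I> B \<notin> M B A} = I"
      using comp_ident[OF ident_hom[OF B]] comp_ident[OF p(1)] by auto
    then have "\<I> B \<notin> J B B"
      using WI not_ordLess_ordLeq ident_hom[OF B] unfolding J_def by fastforce
    then show ?thesis using J B ident_hom[OF B] unfolding proper_ideal_def by metis
  qed
  ultimately show False using max unfolding maximal_ideal_def by blast
qed

theorem corollary3p3:
  fixes U :: "'u set" and G :: "('o, 'm) precat"
  assumes "universe U" and "grothendieck_category U G"
  shows "\<not> (\<exists>M. preadditive_category.maximal_ideal G M)"
  using grothendieck_category.no_maximal_ideal[OF assms(2,1)] by blast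

end
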